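(* Let $\mathcal X$ be a finite nonempty set. Let $\mathbb L_2$ be the set of all functions $p:\bigcup_{t=1}^\infty\mathcal X^t\to[0,1]$ such that $(\mathcal X,p)$ is a probabilistic language space of the second kind. Let $\mathbb L_3$ be the set of all probability measures $P$ on $(\mathcal X^{\mathbb N},\mathscr C)$ such that $(\mathcal X,P)$ is a probabilistic language space of the third kind. Define $\Phi_{32}:\mathbb L_3\to\mathbb L_2$ by $\Phi_{32}(P)(x)=P(\mathcal C(\{x\}))$ for $x\in\bigcup_{t=1}^\infty\mathcal X^t$. Then $\Phi_{32}$ is a bijection.
   Context: For $t\in\mathbb N=\{1,2,\ldots\}$ and $A\subset\mathcal X^t$, let $\mathcal C(A)=\{x\in\mathcal X^{\mathbb N}\mid(x_1,\ldots,x_t)\in A\}$; such sets are called cylinders. $\mathscr C$ denotes the cylindrical $\sigma$-algebra of $\mathcal X^{\mathbb N}$, i.e. the $\sigma$-algebra generated by all cylinders. $(x,y)$ denotes concatenation of finite sequences (an element of $\mathcal X$ is viewed as a sequence of length 1). A probabilistic language space of the second kind is a couple $(\mathcal X,p)$ such that: (1) $\mathcal X$ is a finite nonempty set; (2) $p:\bigcup_{t=1}^\infty\mathcal X^t\to[0,1]$; (3) $\sum_{x\in\mathcal X}p(x)=1$; (4) for all $x\in\bigcup_{t=1}^\infty\mathcal X^t$, $\sum_{y\in\mathcal X}p(x,y)=p(x)$. A probabilistic language space of the third kind is a couple $(\mathcal X,P)$ such that: (1) $\mathcal X$ is a finite nonempty set; (2) $P$ is a probability measure on the cylindrical $\sigma$-algebra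 of $\mathcal X^{\mathbb N}$; (3) $\sum_{x\in\mathcal X}P(\mathcal C(\{x\}))=1$; (4) for all $x\in\bigcup_{t=1}^\infty\mathcal X^t$, $\sum_{y\in\mathcal X}P(\mathcal C(\{(x,y)\}))=P(\mathcal C(\{x\}))$. *)

theory Defs
  imports "HOL-Probability.Probability"
begin

definition words :: "'a set \<Rightarrow> nat \<Rightarrow> 'a list set" where
  "words X t = {xs. length xs = t \<and> set xs \<subseteq> X}"

definition nonempty_words :: "'a set \<Rightarrow> 'a list set" where
  "nonempty_words X = (\<Union>t\<in>{1..}. words X t)"

(* The sequence (x_1, x_2, ...) is the function i \<mapsto> x_{i+1}, so that its first t
   entries are map x [0..<t]. *)
definition sequences :: "'a set \<Rightarrow> (nat \<Rightarrow> 'a) set" where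
  "sequences X = (UNIV \<rightarrow> X)"

(* The length t is an explicit argument because A alone does not determine it when A = {}. *)
definition cylinder :: "'a set \<Rightarrow> nat \<Rightarrow> 'a list set \<Rightarrow> (nat \<Rightarrow> 'a) set" where
  "cylinder X t A = {x \<in> sequences X. map x [0..<t] \<in> A}"

definition cylinders :: "'a set \<Rightarrow> (nat \<Rightarrow> 'a) set set" where
  "cylinders X = {cylinder X t A | t A. 1 \<le> t \<and> A \<subseteq> words X t}"

definition cylindrical_sigma_algebra :: "'a set \<Rightarrow> (nat \<Rightarrow> 'a) set set" where
  "cylindrical_sigma_algebra X = sigma_sets (sequences X) (cylinders X)"

(* HOL functions are total: a function with domain nonempty_words X is represented by the
   one that is undefined outside that domain, hence the extensional function space. *)
definition language_space_2 :: "'a set \<Rightarrow> ('a list \<Rightarrow> real) \<Rightarrow> bool" where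
  "language_space_2 X p \<longleftrightarrow>
     finite X \<and> X \<noteq> {} \<and>
     p \<in> nonempty_words X \<rightarrow>\<^sub>E {0..1} \<and>
     (\<Sum>x\<in>X. p [x]) = 1 \<and>
     (\<forall>x\<in>nonempty_words X. (\<Sum>y\<in>X. p (x @ [y])) = p x)"

definition probability_on_sequences :: "'a set \<Rightarrow> (nat \<Rightarrow> 'a) measure \<Rightarrow> bool" where
  "probability_on_sequences X P \<longleftrightarrow>
     prob_space P \<and> space P = sequences X \<and> sets P = cylindrical_sigma_algebra X"

definition language_space_3 :: "'a set \<Rightarrow> (nat \<Rightarrow> 'a) measure \<Rightarrow> bool" where
  "language_space_3 X P \<longleftrightarrow>
     finite X \<and> X \<noteq> {} \<and>
     probability_on_sequences X P \<and>
     (\<Sum>x\<in>X. measure P (cylinder X 1 {[x]})) = 1 \<and>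
     (\<forall>x\<in>nonempty_words X.
        (\<Sum>y\<in>X. measure P (cylinder X (length (x @ [y])) {x @ [y]})) =
        measure P (cylinder X (length x) {x}))"

definition L2 :: "'a set \<Rightarrow> ('a list \<Rightarrow> real) set" where
  "L2 X = {p. language_space_2 X p}"

definition L3 :: "'a set \<Rightarrow> (nat \<Rightarrow> 'a) measure set" where
  "L3 X = {P. language_space_3 X P}"

definition Phi32 :: "'a set \<Rightarrow> (nat \<Rightarrow> 'a) measure \<Rightarrow> ('a list \<Rightarrow> real)" where
  "Phi32 X P = (\<lambda>x\<in>nonempty_words X. measure P (cylinder X (length x) {x}))"

end

(* Injectivity: the cylinders form an intersection-stable generator of the sigma-algebra, and the
   measure of a cylinder is a finite sum of values of p.

   Surjectivity: condition (4) makes p define an additive content on the algebra of cylinders. Since X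
   is finite, a decreasing sequence of nonempty cylinders has nonempty intersection (Koenig's
   lemma), so the content is continuous at the empty set for trivial reasons, and
   Caratheodory's theorem extends it to a measure. *)

theory Submission imports Defs begin

section \<open>Words, prefixes and the algebra of cylinders\<close>

lemma finite_words: "finite X \<Longrightarrow> finite (words X t)"
  using finite_lists_length_eq[of X t] by (simp add: words_def conj_commute)

lemma words_1: "words X 1 = (\<lambda>x. [x]) ` X"
  by (auto simp: words_def length_Suc_conv)

lemma nonempty_words_iff: "w \<in> nonempty_words X \<longleftrightarrow> 1 \<le> length w \<and> w \<in> words X (length w)"
  by (auto simp: nonempty_words_def words_def)

lemma in_nonempty_words: "w \<in> words X t \<Longrightarrow> 1 \<le> t \<Longrightarrow> w \<in> nonempty_words X"
  by (auto simp: nonempty_words_def)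

lemma length_words: "w \<in> words X t \<Longrightarrow> length w = t"
  by (simp add: words_def)

lemma prefix_in_words: "x \<in> sequences X \<Longrightarrow> map x [0..<t] \<in> words X t"
  by (auto simp: words_def sequences_def)

lemma word_is_prefix:
  assumes "X \<noteq> {}" "w \<in> words X t"
  obtains x where "x \<in> sequences X" "map x [0..<t] = w"
proof -
  obtain a where "a \<in> X" using assms by auto
  \<comment> \<open>From position \<open>t\<close> on, the word is padded with the fixed letter
    \<open>a\<close>.\<close>
  define x where "x = (\<lambda>i. if i < t then w ! i else a)"
  have "x \<in> sequences X"
    using assms(2) \<open>a \<in> X\<close> nth_mem[of _ w] by (simp add: x_def sequences_def words_def Pi_iff subset_iff)
  moreover have "map x [0..<t] = w"
    using assms by (auto simp: x_def words_def intro!: nth_equalityI)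
  ultimately show thesis by (rule that)
qed

text \<open>Every word of length \<open>t\<close> begins some sequence, and that sequence lies in
  the cylinder exactly when the word lies in the base. This makes the content well defined and turns
  disjoint cylinders into disjoint bases.\<close>

lemma cylinder_inject:
  assumes "X \<noteq> {}" "A \<subseteq> words X t" "B \<subseteq> words X t" "cylinder X t A = cylinder X t B"
  shows "A = B"
proof -
  have "w \<in> A \<longleftrightarrow> w \<in> B" if w: "w \<in> words X t" for w
  proof -
    obtain x where "x \<in> sequences X" "map x [0..<t] = w"
      using word_is_prefix[OF assms(1) w] .
    then show ?thesis using assms(4) by (auto simp: cylinder_def)
  qed
  then show ?thesis using assms(2,3) by blast
qed

lemma cylinder_take:
  assumes "s \<le> t"
  shows "cylinder X s A = cylinder X t {w \<in> words X t. take s w \<in> A}"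
  using assms prefix_in_words[of _ X t] by (auto simp: cylinder_def take_map)

lemma cylinder_empty: "cylinder X t {} = {}"
  by (simp add: cylinder_def)

lemma cylinder_words: "cylinder X t (words X t) = sequences X"
  using prefix_in_words[of _ X t] by (auto simp: cylinder_def)

text \<open>Lifting both bases to the larger of the two lengths by \<open>cylinder_take\<close>
  reduces set operations on cylinders to the same operations on sets of words.\<close>

lemma cylinders_same_length:
  assumes "B \<in> cylinders X" "C \<in> cylinders X"
  obtains t A A' where "1 \<le> t" "A \<subseteq> words X t" "A' \<subseteq> words X t"
    "B = cylinder X t A" "C = cylinder X t A'"
proof -
  obtain r A where r: "1 \<le> r" "B = cylinder X r A"
    using assms(1) by (auto simp: cylinders_def)
  obtain s A' where s: "1 \<le> s" "C = cylinder X s A'"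
    using assms(2) by (auto simp: cylinders_def)
  show thesis
    by (rule that[of "max r s"])
      (use r s cylinder_take[of r "max r s" X A] cylinder_take[of s "max r s" X A'] in auto)
qed

lemma cylinder_in_cylinders: "1 \<le> t \<Longrightarrow> A \<subseteq> words X t \<Longrightarrow> cylinder X t A \<in> cylinders X"
  by (auto simp: cylinders_def)

lemma algebra_cylinders: "algebra (sequences X) (cylinders X)"
  unfolding algebra_iff_Un
proof (intro conjI ballI)
  show "cylinders X \<subseteq> Pow (sequences X)"
    by (auto simp: cylinders_def cylinder_def)
  show "{} \<in> cylinders X"
    using cylinder_in_cylinders[of 1 "{}" X] by (simp add: cylinder_empty)
next
  fix B assume "B \<in> cylinders X"
  then obtain t A where t: "1 \<le> t" "B = cylinder X t A"
    by (auto simp: cylinders_def)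
  then have "sequences X - B = cylinder X t (words X t - A)"
    using prefix_in_words[of _ X t] by (auto simp: cylinder_def)
  then show "sequences X - B \<in> cylinders X"
    using t by (simp add: cylinder_in_cylinders)
next
  fix B C assume "B \<in> cylinders X" "C \<in> cylinders X"
  then obtain t A A' where t: "1 \<le> t" "A \<subseteq> words X t" "A' \<subseteq> words X t"
    "B = cylinder X t A" "C = cylinder X t A'"
    by (rule cylinders_same_length)
  then have "B \<union> C = cylinder X t (A \<union> A')"
    by (auto simp: cylinder_def)
  then show "B \<union> C \<in> cylinders X"
    using t by (simp add: cylinder_in_cylinders)
qed

section \<open>Compactness of decreasing sequences of cylinders\<close>

lemma cylinders_compact:
  assumes "finite X" and B: "range B \<subseteq> cylinders X" and "decseq B" and ne: "\<And>n. B n \<noteq> {}"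
  shows "(\<Inter>n. B n) \<noteq> {}"
proof -
  \<comment> \<open>The good words are the nodes of the infinite tree in Koenig's lemma.\<close>
  define good where "good w \<longleftrightarrow> (\<forall>n. \<exists>x\<in>B n. map x [0..<length w] = w)" for w
  have seq: "x \<in> sequences X" if "x \<in> B n" for x n
    using B that by (fastforce simp: cylinders_def cylinder_def)
  have step: "\<exists>y\<in>X. good (w @ [y])" if "good w" for w
  proof (rule ccontr)
    assume "\<not> ?thesis"
    \<comment> \<open>Each letter \<open>y\<close> has an index \<open>N y\<close> at which
      \<open>w @ [y]\<close> is no longer a prefix. Finiteness of \<open>X\<close> bounds these
      indices by \<open>M\<close>, so a sequence in \<open>B M\<close> starting with
      \<open>w\<close> lies in \<open>B (N y)\<close> for its own next letter
      \<open>y\<close>.\<close>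
    then obtain N where N: "\<And>y x. y \<in> X \<Longrightarrow> x \<in> B (N y) \<Longrightarrow> map x [0..<Suc (length w)] \<noteq> w @ [y]"
      unfolding good_def by simp metis
    obtain M where M: "\<And>y. y \<in> X \<Longrightarrow> N y \<le> M"
      using finite_imageI[OF \<open>finite X\<close>, of N] by (auto simp: finite_nat_set_iff_bounded_le)
    obtain x where x: "x \<in> B M" "map x [0..<length w] = w"
      using \<open>good w\<close> by (auto simp: good_def)
    have y: "x (length w) \<in> X" using seq[OF x(1)] by (auto simp: sequences_def)
    have "x \<in> B (N (x (length w)))" using decseqD[OF \<open>decseq B\<close> M[OF y]] x by auto
    from N[OF y this] x show False by simp
  qed
  then obtain g where g: "\<And>w. good w \<Longrightarrow> g w \<in> X \<and> good (w @ [g w])" by metis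
  \<comment> \<open>An infinite branch: starting from the empty word, which is good because no
    \<open>B n\<close> is empty, the letters chosen by \<open>g\<close> are appended one by
    one.\<close>
  define w where "w = rec_nat [] (\<lambda>_ u. u @ [g u])"
  have w: "w 0 = []" "w (Suc n) = w n @ [g (w n)]" for n by (simp_all add: w_def)
  have good: "good (w n)" for n
    by (induction n) (use ne in \<open>auto simp: w g, auto simp: good_def\<close>)
  define s where "s n = g (w n)" for n
  have s_prefix: "map s [0..<n] = w n" for n
    by (induction n) (auto simp: w s_def)
  have "s \<in> B n" for n
  proof -
    have "B n \<in> cylinders X" using B by blast
    then obtain t A where t: "B n = cylinder X t A" by (auto simp: cylinders_def)
    \<comment> \<open>Membership in \<open>B n\<close> depends only on the first \<open>t\<close>
      letters, and there \<open>s\<close> agrees with this \<open>x\<close>.\<close>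
    obtain x where "x \<in> B n" "map x [0..<length (w t)] = w t"
      using good[of t] by (auto simp: good_def)
    moreover have "length (w t) = t" using arg_cong[OF s_prefix[of t], of length] by simp
    moreover have "s \<in> sequences X" using g[OF good] by (simp add: sequences_def s_def)
    ultimately show ?thesis using t s_prefix[of t] by (auto simp: cylinder_def)
  qed
  then show ?thesis by auto
qed

section \<open>The content on cylinders\<close>

text \<open>By condition (4), replacing each word by its one-letter extensions leaves the sum
  unchanged; this is repeated \<open>t - s\<close> times.\<close>

lemma sum_extensions:
  assumes p: "language_space_2 X p" and A: "A \<subseteq> words X s" and "1 \<le> s" "s \<le> t"
  shows "sum p {w \<in> words X t. take s w \<in> A} = sum p A"
  using \<open>s \<le> t\<close>
proof (induction rule: dec_induct)
  case base
  have "{w \<in> words X s. take s w \<in> A} = A" using A by (auto simp: words_def)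
  then show ?case by simp
next
  case (step t)
  let ?E = "{w \<in> words X t. take s w \<in> A}"
  \<comment> \<open>Splitting off the last letter is unique, and as \<open>s \<le> t\<close> it does
    not touch the prefix tested by \<open>A\<close>.\<close>
  have "{w \<in> words X (Suc t). take s w \<in> A} = (\<lambda>(w, y). w @ [y]) ` (?E \<times> X)"
  proof (intro equalityI subsetI)
    fix w assume w: "w \<in> {w \<in> words X (Suc t). take s w \<in> A}"
    then obtain v y where "w = v @ [y]" by (cases w rule: rev_cases) (auto simp: words_def)
    then show "w \<in> (\<lambda>(w, y). w @ [y]) ` (?E \<times> X)"
      using w \<open>s \<le> t\<close> by (auto simp: words_def image_iff)
  qed (use \<open>s \<le> t\<close> in \<open>auto simp: words_def\<close>)
  then have "sum p {w \<in> words X (Suc t). take s w \<in> A} = (\<Sum>(w, y)\<in>?E \<times> X. p (w @ [y]))"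
    by (simp add: sum.reindex inj_on_def case_prod_beta' prod_eq_iff)
  also have "\<dots> = (\<Sum>w\<in>?E. \<Sum>y\<in>X. p (w @ [y]))"
    by (rule sum.cartesian_product[symmetric])
  also have "\<dots> = sum p ?E"
    using p \<open>1 \<le> s\<close> \<open>s \<le> t\<close>
    by (intro sum.cong) (auto simp: language_space_2_def in_nonempty_words)
  finally show ?case using step.IH by simp
qed

text \<open>A set has many presentations as a cylinder, with different lengths \<open>t\<close>;
  \<open>THE\<close> selects the value on which they all agree.\<close>

definition content :: "'a set \<Rightarrow> ('a list \<Rightarrow> real) \<Rightarrow> (nat \<Rightarrow> 'a) set \<Rightarrow> real" where
  "content X p B =
     (THE r. \<exists>t A. 1 \<le> t \<and> A \<subseteq> words X t \<and> B = cylinder X t A \<and> r = sum p A)"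

text \<open>Two presentations are compared at the larger length: \<open>cylinder_inject\<close>
  identifies the lifted bases, and \<open>sum_extensions\<close> shows that lifting preserves the
  sums.\<close>

lemma content_cylinder:
  assumes p: "language_space_2 X p" and A: "1 \<le> t" "A \<subseteq> words X t"
  shows "content X p (cylinder X t A) = sum p A"
  unfolding content_def
proof (rule the_equality)
  show "\<exists>s B. 1 \<le> s \<and> B \<subseteq> words X s \<and> cylinder X t A = cylinder X s B \<and> sum p A = sum p B"
    using A by blast
next
  fix r assume "\<exists>s B. 1 \<le> s \<and> B \<subseteq> words X s \<and> cylinder X t A = cylinder X s B \<and> r = sum p B"
  then obtain s B where B: "1 \<le> s" "B \<subseteq> words X s" "cylinder X t A = cylinder X s B" "r = sum p B"
    by blast
  let ?m = "max s t"
  have "{w \<in> words X ?m. take t w \<in> A} = {w \<in> words X ?m. take s w \<in> B}"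
  proof (rule cylinder_inject)
    show "X \<noteq> {}" using p by (simp add: language_space_2_def)
    show "cylinder X ?m {w \<in> words X ?m. take t w \<in> A} = cylinder X ?m {w \<in> words X ?m. take s w \<in> B}"
      using cylinder_take[of t ?m X A] cylinder_take[of s ?m X B] B(3) by simp
  qed auto
  then show "r = sum p A"
    using sum_extensions[OF p A(2,1), of ?m] sum_extensions[OF p B(2,1), of ?m] B(4) by simp
qed

lemma language_space_2_nonneg:
  "language_space_2 X p \<Longrightarrow> A \<subseteq> words X t \<Longrightarrow> 1 \<le> t \<Longrightarrow> 0 \<le> sum p A"
  unfolding language_space_2_def
  by (rule sum_nonneg) (metis PiE_mem atLeastAtMost_iff in_nonempty_words subsetD)

section \<open>Extension of the content to a measure\<close>

lemma content_extends:
  assumes p: "language_space_2 X p"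
  obtains P where "space P = sequences X" "sets P = cylindrical_sigma_algebra X"
    "\<And>t A. 1 \<le> t \<Longrightarrow> A \<subseteq> words X t \<Longrightarrow> emeasure P (cylinder X t A) = ennreal (sum p A)"
proof -
  have X: "finite X" "X \<noteq> {}" using p by (auto simp: language_space_2_def)
  interpret algebra "sequences X" "cylinders X" by (rule algebra_cylinders)
  let ?\<mu> = "\<lambda>B. ennreal (content X p B)"
  have empty: "?\<mu> {} = 0"
    using content_cylinder[OF p, of 1 "{}"] by (simp add: cylinder_empty)
  have "\<exists>\<mu>. (\<forall>B\<in>cylinders X. \<mu> B = ?\<mu> B) \<and>
    measure_space (sequences X) (sigma_sets (sequences X) (cylinders X)) \<mu>"
  proof (rule caratheodory_empty_continuous)
    show "positive (cylinders X) ?\<mu>"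
      using empty by (simp add: positive_def)
    show "additive (cylinders X) ?\<mu>"
      unfolding additive_def
    proof (intro ballI impI)
      fix B C assume "B \<in> cylinders X" "C \<in> cylinders X" and disj: "B \<inter> C = {}"
      then obtain t A A' where t: "1 \<le> t" "A \<subseteq> words X t" "A' \<subseteq> words X t"
        "B = cylinder X t A" "C = cylinder X t A'"
        by (meson cylinders_same_length)
      have "cylinder X t (A \<inter> A') = cylinder X t {}"
        using t disj by (auto simp: cylinder_def)
      then have "A \<inter> A' = {}"
        using cylinder_inject[OF X(2), of "A \<inter> A'" t "{}"] t by auto
      then have "sum p (A \<union> A') = sum p A + sum p A'"
        using t X by (intro sum.union_disjoint) (auto intro: finite_subset[OF _ finite_words])
      moreover have "B \<union> C = cylinder X t (A \<union> A')"
        using t by (auto simp: cylinder_def)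
      \<comment> \<open>Since \<open>ennreal\<close> sends negative reals to 0, it is additive here
        because both sums are nonnegative.\<close>
      ultimately show "?\<mu> (B \<union> C) = ?\<mu> B + ?\<mu> C"
        using t by (simp add: content_cylinder[OF p] ennreal_plus language_space_2_nonneg[OF p])
    qed
  next
    fix B assume B: "range B \<subseteq> cylinders X" "decseq B" "(\<Inter>n. B n) = {}"
    \<comment> \<open>By compactness the sets are empty from some index on, so the limit is that of
      an eventually zero sequence.\<close>
    then obtain n where "B n = {}" using cylinders_compact[OF X(1)] by metis
    then have "B m = {}" if "n \<le> m" for m
      using decseqD[OF B(2) that] by auto
    then have "\<forall>\<^sub>F m in sequentially. ?\<mu> (B m) = 0"
      using empty unfolding eventually_sequentially by (intro exI[of _ n]) simp
    then show "(\<lambda>m. ?\<mu> (B m)) \<longlonglongrightarrow> 0"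
      by (rule tendsto_eventually)
  \<comment> \<open>What remains is finiteness of the content, clear for values of the form
    \<open>ennreal r\<close>.\<close>
  qed simp
  then obtain \<mu> where \<mu>: "\<And>B. B \<in> cylinders X \<Longrightarrow> \<mu> B = ?\<mu> B"
    and ms: "measure_space (sequences X) (cylindrical_sigma_algebra X) \<mu>"
    by (auto simp: cylindrical_sigma_algebra_def)
  let ?P = "measure_of (sequences X) (cylinders X) \<mu>"
  show thesis
  proof (rule that)
    show "space ?P = sequences X" "sets ?P = cylindrical_sigma_algebra X"
      using space_closed by (simp_all add: space_measure_of sets_measure_of cylindrical_sigma_algebra_def)
    fix t A assume t: "1 \<le> t" "A \<subseteq> words X t"
    then have cyl: "cylinder X t A \<in> cylinders X" by (rule cylinder_in_cylinders)
    \<comment> \<open>\<open>measure_of\<close> falls back to the zero measure unless the given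
      function is a measure, so positivity and countable additivity are checked.\<close>
    have "emeasure ?P (cylinder X t A) = \<mu> (cylinder X t A)"
    proof (rule emeasure_measure_of[OF refl space_closed])
      show "cylinder X t A \<in> sets ?P"
        using cyl space_closed by (simp add: sets_measure_of)
      show "positive (sets ?P) \<mu>" "countably_additive (sets ?P) \<mu>"
        using ms space_closed
        by (simp_all add: sets_measure_of measure_space_def cylindrical_sigma_algebra_def)
    qed
    then show "emeasure ?P (cylinder X t A) = ennreal (sum p A)"
      using \<mu>[OF cyl] content_cylinder[OF p t] by simp
  qed
qed

section \<open>Measures are determined by their values on single words\<close>

lemma measure_cylinder:
  assumes "finite X" and P: "probability_on_sequences X P" and t: "1 \<le> t" "A \<subseteq> words X t"
  shows "measure P (cylinder X t A) = sum (Phi32 X P) A"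
proof -
  interpret prob_space P using P by (simp add: probability_on_sequences_def)
  have meas: "cylinder X t A' \<in> sets P" if "A' \<subseteq> words X t" for A'
    using P t(1) that
    by (auto simp: probability_on_sequences_def cylindrical_sigma_algebra_def cylinder_in_cylinders)
  \<comment> \<open>A finite disjoint union, since \<open>X\<close> is finite and a sequence has
    only one prefix of length \<open>t\<close>.\<close>
  have "cylinder X t A = (\<Union>w\<in>A. cylinder X t {w})"
    by (auto simp: cylinder_def)
  moreover have "measure P (\<Union>w\<in>A. cylinder X t {w}) = (\<Sum>w\<in>A. measure P (cylinder X t {w}))"
  proof (rule finite_measure_finite_Union)
    show "finite A" using t(2) finite_words[OF assms(1)] by (rule finite_subset)
    show "(\<lambda>w. cylinder X t {w}) ` A \<subseteq> sets P" using t(2) by (auto intro: meas)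
    show "disjoint_family_on (\<lambda>w. cylinder X t {w}) A"
      by (auto simp: disjoint_family_on_def cylinder_def)
  qed
  moreover have "\<dots> = sum (Phi32 X P) A"
    using t length_words by (intro sum.cong) (auto simp: Phi32_def in_nonempty_words subset_iff)
  ultimately show ?thesis by simp
qed

lemma probability_on_sequences_eqI:
  assumes "finite X" and P: "probability_on_sequences X P" and Q: "probability_on_sequences X Q"
    and eq: "Phi32 X P = Phi32 X Q"
  shows "P = Q"
proof -
  interpret P: prob_space P using P by (simp add: probability_on_sequences_def)
  interpret Q: prob_space Q using Q by (simp add: probability_on_sequences_def)
  interpret algebra "sequences X" "cylinders X" by (rule algebra_cylinders)
  show ?thesis
  \<comment> \<open>The covering sequence is constant: the whole space is itself a cylinder and has
    finite measure.\<close>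
  proof (rule measure_eqI_generator_eq[where E = "cylinders X" and A = "\<lambda>_. sequences X"])
    show "Int_stable (cylinders X)" by (auto simp: Int_stable_def)
    show "sets P = sigma_sets (sequences X) (cylinders X)" "sets Q = sigma_sets (sequences X) (cylinders X)"
      using P Q by (auto simp: probability_on_sequences_def cylindrical_sigma_algebra_def)
    fix B assume "B \<in> cylinders X"
    then obtain t A where "1 \<le> t" "A \<subseteq> words X t" "B = cylinder X t A"
      by (auto simp: cylinders_def)
    then show "emeasure P B = emeasure Q B"
      using measure_cylinder[OF assms(1) P] measure_cylinder[OF assms(1) Q] eq
      by (simp add: P.emeasure_eq_measure Q.emeasure_eq_measure)
  qed (use space_closed in auto)
qed

section \<open>The map is onto the spaces of the second kind, and the bijection\<close>

lemma Phi32_in_L2: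
  assumes "P \<in> L3 X"
  shows "Phi32 X P \<in> L2 X"
proof -
  have P: "language_space_3 X P" using assms by (simp add: L3_def)
  then interpret prob_space P by (simp add: language_space_3_def probability_on_sequences_def)
  \<comment> \<open>\<open>Phi32 X P\<close> is \<open>undefined\<close> off
    \<open>nonempty_words X\<close>, so every argument in conditions (3) and (4) must be shown to
    lie there.\<close>
  have one: "[x] \<in> nonempty_words X" if "x \<in> X" for x
    using that by (auto simp: nonempty_words_iff words_def)
  have app: "w @ [y] \<in> nonempty_words X" if "w \<in> nonempty_words X" "y \<in> X" for w y
    using that by (auto simp: nonempty_words_iff words_def)
  show ?thesis
    using P by (auto simp: L2_def language_space_2_def language_space_3_def Phi32_def one app)
qed

lemma L2_subset_Phi32_image:
  assumes "p \<in> L2 X"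
  shows "p \<in> Phi32 X ` L3 X"
proof -
  have p: "language_space_2 X p" using assms by (simp add: L2_def)
  then have X: "finite X" "X \<noteq> {}" and ext: "p \<in> nonempty_words X \<rightarrow>\<^sub>E {0..1}"
    and p1: "(\<Sum>x\<in>X. p [x]) = 1"
    and p_ext: "\<And>w. w \<in> nonempty_words X \<Longrightarrow> (\<Sum>y\<in>X. p (w @ [y])) = p w"
    by (auto simp: language_space_2_def)
  obtain P where P: "space P = sequences X" "sets P = cylindrical_sigma_algebra X"
    and em: "\<And>t A. 1 \<le> t \<Longrightarrow> A \<subseteq> words X t \<Longrightarrow> emeasure P (cylinder X t A) = ennreal (sum p A)"
    using content_extends[OF p] by metis
  have m: "measure P (cylinder X (length w) {w}) = p w" if w: "w \<in> nonempty_words X" for w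
  proof -
    have "emeasure P (cylinder X (length w) {w}) = ennreal (sum p {w})"
      using w by (intro em) (auto simp: nonempty_words_iff)
    moreover have "0 \<le> p w" using w ext by auto
    ultimately show ?thesis by (simp add: measure_def)
  qed
  have one: "[x] \<in> nonempty_words X" if "x \<in> X" for x
    using that by (auto simp: nonempty_words_iff words_def)
  have app: "w @ [y] \<in> nonempty_words X" if "w \<in> nonempty_words X" "y \<in> X" for w y
    using that by (auto simp: nonempty_words_iff words_def)
  \<comment> \<open>The whole space is the cylinder over all words of length 1, so condition (3)
    gives total mass 1.\<close>
  have "sum p (words X 1) = 1"
    using p1 by (simp only: words_1) (simp add: sum.reindex inj_on_def)
  then have "prob_space P"
    using em[of 1 "words X 1"] P(1) by (intro prob_spaceI) (simp add: cylinder_words)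
  moreover have "(\<Sum>x\<in>X. measure P (cylinder X 1 {[x]})) = 1"
    using m[OF one] p1 by simp
  moreover have "(\<Sum>y\<in>X. measure P (cylinder X (length (w @ [y])) {w @ [y]})) =
      measure P (cylinder X (length w) {w})" if "w \<in> nonempty_words X" for w
    using m[OF app[OF that]] m[OF that] p_ext[OF that] by simp
  ultimately have "P \<in> L3 X"
    using X P by (simp add: L3_def language_space_3_def probability_on_sequences_def)
  moreover have "Phi32 X P = p"
    \<comment> \<open>Both functions are \<open>undefined\<close> off
      \<open>nonempty_words X\<close>, so agreement on it suffices.\<close>
    unfolding Phi32_def by (rule extensionalityI[of _ "nonempty_words X"]) (use ext m in \<open>auto simp: PiE_def\<close>)
  ultimately show ?thesis by blast
qed

theorem proposition6:
  fixes X :: "'a set"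
  assumes "finite X" and "X \<noteq> {}"
  shows "bij_betw (Phi32 X) (L3 X) (L2 X)"
  unfolding bij_betw_def
proof
  show "inj_on (Phi32 X) (L3 X)"
    using probability_on_sequences_eqI[OF assms(1)]
    by (auto simp: inj_on_def L3_def language_space_3_def)
  show "Phi32 X ` L3 X = L2 X"
    using Phi32_in_L2 L2_subset_Phi32_image by blast
qed

end
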